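(* Let $r \geq 1$ be an integer, let $\xi_1, \ldots, \xi_r \in \mathbb{R}$ and $\alpha, \beta, \omega, \varphi \in \mathbb{R}$. Assume that $0 < \alpha < 1$, $\beta > 1$, and that either $\omega \not\equiv 0 \bmod \pi$ or $\varphi \not\equiv \frac{\pi}{2} \bmod \pi$. For any $n \geq 1$, let $\ell_{0,n}, \ldots, \ell_{r,n} \in \mathbb{Z}$ be such that, as $n \to \infty$, $$\max_{0 \leq i \leq r} |\ell_{i,n}| \leq \beta^{n+o(n)}$$ and $$|\ell_{0,n} + \ell_{1,n}\xi_1 + \ldots + \ell_{r,n}\xi_r| = \alpha^{n+o(n)} \Big( |\cos(n\omega + \varphi)| + o(1) \Big).$$ Then: (i) $\dim_{\mathbb{Q}} \mathrm{Span}_{\mathbb{Q}}(1, \xi_1, \ldots, \xi_r) \geq 1 - \frac{\log \alpha}{\log \beta}$. (ii) For any $\kappa > 1 - \frac{\log \beta}{\log \alpha}$ there exists $q_0$ such that for any $q, p_1, \ldots, p_r \in \mathbb{Z}$ with $q \geq q_0$ and $q > 0$, we have $$\max\Big( \Big|\xi_1 - \frac{p_1}{q}\Big|, \ldots, \Big|\xi_r - \frac{p_r}{q}\Big| \Big) \geq \frac{1}{q^{\kappa}}.$$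
   Context: The asymptotic hypotheses mean the following. There is a real sequence $(u_n)_{n\ge 1}$ with $u_n/n \to 0$ such that $\max_{0\le i\le r}|\ell_{i,n}| \leq \beta^{n+u_n}$ for all $n$. There are real sequences $(v_n)_{n\ge 1}$, $(w_n)_{n\ge 1}$ with $v_n/n \to 0$ and $w_n \to 0$ such that $|\ell_{0,n} + \ell_{1,n}\xi_1 + \ldots + \ell_{r,n}\xi_r| = \alpha^{n+v_n}\big(|\cos(n\omega+\varphi)| + w_n\big)$ for all $n$. $\mathrm{Span}_{\mathbb{Q}}(1,\xi_1,\ldots,\xi_r)$ is the $\mathbb{Q}$-linear subspace of $\mathbb{R}$ spanned by $1,\xi_1,\ldots,\xi_r$. For real $x,y$, the notation $x \equiv y \bmod \pi$ means $x - y \in \pi\mathbb{Z}$. *)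

theory Defs
  imports "HOL-Analysis.Analysis"
begin

(* Provides rat_vs.span and rat_vs.dim on sets of reals; the unqualified
   span and dim of HOL-Analysis are those over the reals. *)
global_interpretation rat_vs: vector_space "\<lambda>(c::rat) (x::real). of_rat c * x"
  by unfold_locales (simp_all add: algebra_simps of_rat_add of_rat_mult)

end

theory Submission
  imports Defs "HOL-Real_Asymp.Real_Asymp"
begin

text \<open>
  If \<open>q\<close> and \<open>p\<close> are such that all \<open>p i / q\<close> are very close to \<open>\<xi> i\<close>, then
  \<open>q * l\<^sub>0 + (\<Sum>i. l\<^sub>i * p i)\<close> differs from \<open>q * L n\<close>, where \<open>L n\<close> is the linear form in the
  \<open>\<xi> i\<close>, by a small error. For an \<open>n\<close> with \<open>q * \<bar>L n\<bar>\<close> just below 1, this error is smaller than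
  \<open>q * \<bar>L n\<bar>\<close>, so that the sum is a nonzero integer of absolute value below 1. This proves (ii), over any
  finite index set. For (i), rewrite the forms in a rational basis containing 1 and play
  (ii) off against Dirichlet's theorem on simultaneous approximation. The oscillation is harmless
  because one of \<open>\<bar>cos x\<bar>\<close>, \<open>\<bar>cos (x + \<omega>)\<bar>\<close> is at least \<open>\<bar>sin \<omega>\<bar> / 2\<close>.
\<close>

section \<open>Sequences of the form C \<gamma>^(n + o(n))\<close>

text \<open>The difference is n times \<open>ln C / n + ln \<gamma> * (v n / n)\<close>, and this
  second factor tends to 0. So constant factors and the o(n) in the exponent are both absorbed by
  \<open>\<epsilon> * real n\<close>, and later estimates only compare arguments of exp.\<close>

lemma eventually_ln_mult_powr:
  fixes v :: "nat \<Rightarrow> real"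
  assumes "(\<lambda>n. v n / real n) \<longlonglongrightarrow> 0" "\<gamma> > 0" "C > 0" "\<epsilon> > 0"
  shows "\<forall>\<^sub>F n in sequentially. \<bar>ln (C * \<gamma> powr (real n + v n)) - ln \<gamma> * real n\<bar> \<le> \<epsilon> * real n"
proof -
  have "(\<lambda>n. ln C * (1 / real n) + ln \<gamma> * (v n / real n)) \<longlonglongrightarrow> ln C * 0 + ln \<gamma> * 0"
    by (intro tendsto_intros assms lim_1_over_n)
  then have "\<forall>\<^sub>F n in sequentially. \<bar>ln C * (1 / real n) + ln \<gamma> * (v n / real n)\<bar> < \<epsilon>"
    using \<open>\<epsilon> > 0\<close> by (auto simp: tendsto_iff dist_real_def)
  with eventually_gt_at_top[of 0] show ?thesis
  proof eventually_elim
    case (elim n)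
    have "ln (C * \<gamma> powr (real n + v n)) - ln \<gamma> * real n
        = real n * (ln C * (1 / real n) + ln \<gamma> * (v n / real n))"
      using assms elim by (simp add: ln_mult ln_powr field_simps)
    then show ?case
      using elim by (simp add: abs_mult mult.commute)
  qed
qed

lemma eventually_mult_powr_le_exp:
  fixes v :: "nat \<Rightarrow> real"
  assumes "(\<lambda>n. v n / real n) \<longlonglongrightarrow> 0" "\<gamma> > 0" "C > 0" "\<epsilon> > 0"
  shows "\<forall>\<^sub>F n in sequentially. C * \<gamma> powr (real n + v n) \<le> exp ((ln \<gamma> + \<epsilon>) * real n)"
  using eventually_ln_mult_powr[OF assms]
proof eventually_elim
  case (elim n)
  have "C * \<gamma> powr (real n + v n) > 0" using assms by simp
  with elim show ?case by (subst ln_le_cancel_iff[symmetric]) (auto simp: algebra_simps abs_le_iff)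
qed

lemma eventually_exp_le_mult_powr:
  fixes v :: "nat \<Rightarrow> real"
  assumes "(\<lambda>n. v n / real n) \<longlonglongrightarrow> 0" "\<gamma> > 0" "C > 0" "\<epsilon> > 0"
  shows "\<forall>\<^sub>F n in sequentially. exp ((ln \<gamma> - \<epsilon>) * real n) \<le> C * \<gamma> powr (real n + v n)"
  using eventually_ln_mult_powr[OF assms]
proof eventually_elim
  case (elim n)
  have "C * \<gamma> powr (real n + v n) > 0" using assms by simp
  with elim show ?case by (subst ln_le_cancel_iff[symmetric]) (auto simp: algebra_simps abs_le_iff)
qed

section \<open>Oscillation of the cosine factor\<close>

text \<open>If \<omega> is a multiple of \<pi>, the absolute value of the cosine is the constant
  \<open>\<bar>cos \<phi>\<bar>\<close>, nonzero by the second alternative of the assumption.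
  Otherwise \<open>sin \<omega>\<close> is nonzero, and expanding it as the sine of (x + \<omega>) -
  x shows that two consecutive cosines cannot both be small.\<close>

lemma cos_oscillation_lower_bound:
  fixes \<omega> \<phi> :: real
  assumes "\<not> (\<exists>k::int. \<omega> - 0 = of_int k * pi) \<or> \<not> (\<exists>k::int. \<phi> - pi / 2 = of_int k * pi)"
  obtains c where "c > 0"
    "\<And>n. \<exists>m\<in>{n, Suc n}. c \<le> \<bar>cos (real m * \<omega> + \<phi>)\<bar>"
proof (cases "\<exists>k::int. \<omega> = of_int k * pi")
  case True
  then obtain k :: int where k: "\<omega> = of_int k * pi" by blast
  have "cos \<phi> \<noteq> 0"
  proof
    assume "cos \<phi> = 0"
    then obtain j :: int where "\<phi> = of_int j * pi + pi / 2" unfolding cos_zero_iff_int2 by auto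
    with assms k show False by auto
  qed
  moreover have "\<bar>cos (real n * \<omega> + \<phi>)\<bar> = \<bar>cos \<phi>\<bar>" for n
  proof -
    have "sin (real n * \<omega>) = 0" unfolding sin_zero_iff_int2
      by (rule exI[of _ "int n * k"]) (simp add: k)
    then have "\<bar>cos (real n * \<omega>)\<bar> = 1" using sin_cos_squared_add[of "real n * \<omega>"]
      by (simp add: power2_eq_1_iff) auto
    then show ?thesis using \<open>sin (real n * \<omega>) = 0\<close> by (simp add: cos_add abs_mult)
  qed
  ultimately show thesis by (intro that[of "\<bar>cos \<phi>\<bar>"]) auto
next
  case False
  then have "sin \<omega> \<noteq> 0" unfolding sin_zero_iff_int2 by simp
  moreover have "\<exists>m\<in>{n, Suc n}. \<bar>sin \<omega>\<bar> / 2 \<le> \<bar>cos (real m * \<omega> + \<phi>)\<bar>" for n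
  proof -
    define x where "x = real n * \<omega> + \<phi>"
    have "sin \<omega> = sin (x + \<omega>) * cos x - cos (x + \<omega>) * sin x"
      using sin_diff[of "x + \<omega>" x] by simp
    then have "\<bar>sin \<omega>\<bar> \<le> \<bar>sin (x + \<omega>)\<bar> * \<bar>cos x\<bar> + \<bar>cos (x + \<omega>)\<bar> * \<bar>sin x\<bar>"
      by (metis abs_mult abs_triangle_ineq4)
    also have "\<dots> \<le> 1 * \<bar>cos x\<bar> + \<bar>cos (x + \<omega>)\<bar> * 1"
      by (intro add_mono mult_mono) auto
    finally have "\<bar>sin \<omega>\<bar> \<le> \<bar>cos x\<bar> + \<bar>cos (x + \<omega>)\<bar>" by simp
    moreover have "real (Suc n) * \<omega> + \<phi> = x + \<omega>" by (simp add: x_def algebra_simps)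
    ultimately have "\<bar>sin \<omega>\<bar> / 2 \<le> \<bar>cos x\<bar> \<or> \<bar>sin \<omega>\<bar> / 2 \<le> \<bar>cos (real (Suc n) * \<omega> + \<phi>)\<bar>"
      by (simp only:) linarith
    then show ?thesis unfolding x_def by blast
  qed
  ultimately show thesis using that[of "\<bar>sin \<omega>\<bar> / 2"] by simp
qed

section \<open>Approximation by fractions with a common denominator\<close>

text \<open>The rates \<open>a\<close> and \<open>b\<close> stand for \<open>- ln \<alpha>\<close>
  and \<open>ln \<beta>\<close>. The lower bound is required at one of two consecutive indices only,
  which is what the cosine permits. The index set is arbitrary because the locale serves twice: for
  the given numbers \<open>\<xi> i\<close>, and for a rational basis with 1 removed.\<close>

locale small_linear_forms =
  fixes I :: "'a set" and \<xi> :: "'a \<Rightarrow> real" and l\<^sub>0 :: "nat \<Rightarrow> int" and l :: "'a \<Rightarrow> nat \<Rightarrow> int"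
    and L :: "nat \<Rightarrow> real" and a b :: real
  assumes finite_I: "finite I" and a_pos: "a > 0" and b_pos: "b > 0"
    and L_eq: "L n = of_int (l\<^sub>0 n) + (\<Sum>i\<in>I. of_int (l i n) * \<xi> i)"
    and coeff: "\<epsilon> > 0 \<Longrightarrow>
      \<forall>\<^sub>F n in sequentially. \<forall>i\<in>I. \<bar>of_int (l i n)\<bar> \<le> exp ((b + \<epsilon>) * real n)"
    and upper: "\<epsilon> > 0 \<Longrightarrow> \<forall>\<^sub>F n in sequentially. \<bar>L n\<bar> \<le> exp (- (a - \<epsilon>) * real n)"
    and lower: "\<epsilon> > 0 \<Longrightarrow>
      \<forall>\<^sub>F n in sequentially. \<exists>m\<in>{n, Suc n}. exp (- (a + \<epsilon>) * real m) \<le> \<bar>L m\<bar>"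
begin

text \<open>Write q = exp x and take m slightly above \<open>x / (a - 2 * \<epsilon>)\<close>, so
  that \<open>exp x * \<bar>L m\<bar>\<close> is at most 1/2. The replacement error is smaller than
  this quantity as soon as \<open>(a + b + 2 * \<epsilon>) * m + ln K \<le> \<kappa> * x\<close>,
  which holds for large x if
  \<open>(a + b + 2 * \<epsilon>) / (a - 2 * \<epsilon>) < \<kappa>\<close>. For \<epsilon> = 0 this
  ratio is 1 + b / a.\<close>

lemma simultaneous_approximation_exponent:
  assumes "\<kappa> > 1 + b / a"
  shows "\<exists>q\<^sub>0::int. \<forall>(q::int) (p :: 'a \<Rightarrow> int). q \<ge> q\<^sub>0 \<and> q > 0 \<longrightarrow>
    (\<exists>i\<in>I. \<bar>\<xi> i - real_of_int (p i) / real_of_int q\<bar> \<ge> 1 / real_of_int q powr \<kappa>)"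
proof -
  \<comment> \<open>The added 1 makes the error bound strict and keeps \<open>ln K\<close>
    meaningful when \<open>I\<close> is empty.\<close>
  define K where "K = real (card I) + 1"
  have "((\<lambda>\<epsilon>. (a + b + 2 * \<epsilon>) / (a - 2 * \<epsilon>)) \<longlongrightarrow> (a + b + 2 * 0) / (a - 2 * 0)) (at_right 0)"
    using a_pos by (intro tendsto_intros) auto
  moreover have "(a + b + 2 * 0) / (a - 2 * 0) < \<kappa>"
    using assms a_pos by (simp add: field_simps)
  ultimately have "\<forall>\<^sub>F \<epsilon> in at_right 0. (a + b + 2 * \<epsilon>) / (a - 2 * \<epsilon>) < \<kappa>"
    by (rule order_tendstoD)
  moreover have "\<forall>\<^sub>F \<epsilon> in at_right 0. \<epsilon> < a / 2"
    using a_pos by (intro eventually_at_right_less order_tendstoD(2)[OF tendsto_ident_at]) auto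
  moreover have "\<forall>\<^sub>F \<epsilon>::real in at_right 0. 0 < \<epsilon>" by (rule eventually_at_right_less)
  ultimately have "\<forall>\<^sub>F \<epsilon> in at_right 0.
      (a + b + 2 * \<epsilon>) / (a - 2 * \<epsilon>) < \<kappa> \<and> \<epsilon> < a / 2 \<and> 0 < \<epsilon>"
    by eventually_elim auto
  then obtain \<epsilon> where \<epsilon>: "(a + b + 2 * \<epsilon>) / (a - 2 * \<epsilon>) < \<kappa>" "\<epsilon> < a / 2" "0 < \<epsilon>"
    using eventually_happens' trivial_limit_at_right_real by blast
  define \<delta> where "\<delta> = \<kappa> - (a + b + 2 * \<epsilon>) / (a - 2 * \<epsilon>)"
  have "\<delta> > 0" using \<epsilon> by (simp add: \<delta>_def)
  have "a - 2 * \<epsilon> > 0" using \<epsilon> by simp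
  \<comment> \<open>This provides \<open>\<epsilon> * real m > 1\<close>, which pushes
    \<open>exp x * \<bar>L m\<bar>\<close> below exp (-1).\<close>
  have "\<forall>\<^sub>F n::nat in sequentially. real n > 1 / \<epsilon>"
    using filterlim_real_sequentially by (auto simp: filterlim_at_top_dense)
  with coeff[OF \<open>\<epsilon> > 0\<close>] upper[OF \<open>\<epsilon> > 0\<close>] lower[OF \<open>\<epsilon> > 0\<close>]
  have "\<forall>\<^sub>F n in sequentially. (\<forall>i\<in>I. \<bar>of_int (l i n)\<bar> \<le> exp ((b + \<epsilon>) * real n)) \<and>
      \<bar>L n\<bar> \<le> exp (- (a - \<epsilon>) * real n) \<and> (\<exists>m\<in>{n, Suc n}. exp (- (a + \<epsilon>) * real m) \<le> \<bar>L m\<bar>) \<and>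
      real n > 1 / \<epsilon>"
    by eventually_elim blast
  then obtain N where N: "\<And>n. n \<ge> N \<Longrightarrow> (\<forall>i\<in>I. \<bar>of_int (l i n)\<bar> \<le> exp ((b + \<epsilon>) * real n)) \<and>
      \<bar>L n\<bar> \<le> exp (- (a - \<epsilon>) * real n) \<and> (\<exists>m\<in>{n, Suc n}. exp (- (a + \<epsilon>) * real m) \<le> \<bar>L m\<bar>) \<and>
      real n > 1 / \<epsilon>"
    unfolding eventually_sequentially by blast
  \<comment> \<open>The first entry forces \<open>n \<ge> N\<close>. The second lets the slack
    \<open>\<delta> * x\<close> absorb \<open>ln K\<close> and the overshoot of m beyond
    \<open>x / (a - 2 * \<epsilon>)\<close>, which is at most 2: one from the ceiling, one from a
    possible step to \<open>Suc n\<close>.\<close>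
  define x\<^sub>0 where "x\<^sub>0 = max (real N * (a - 2 * \<epsilon>)) (((a + b + 2 * \<epsilon>) * 2 + ln K) / \<delta> + 1)"
  show ?thesis
  proof (intro exI[of _ "\<lceil>exp x\<^sub>0\<rceil>"] allI impI, rule ccontr)
    fix q :: int and p :: "'a \<Rightarrow> int"
    assume q: "q \<ge> \<lceil>exp x\<^sub>0\<rceil> \<and> q > 0"
      and "\<not> (\<exists>i\<in>I. \<bar>\<xi> i - real_of_int (p i) / real_of_int q\<bar> \<ge> 1 / real_of_int q powr \<kappa>)"
    then have close: "\<bar>\<xi> i - real_of_int (p i) / real_of_int q\<bar> < 1 / real_of_int q powr \<kappa>"
      if "i \<in> I" for i
      using that by force
    define x where "x = ln (real_of_int q)"
    have qx: "real_of_int q = exp x" using q by (simp add: x_def)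
    have "exp x\<^sub>0 \<le> exp x" using q by (simp add: qx[symmetric] ceiling_le_iff)
    then have "x\<^sub>0 \<le> x" by simp
    then have x: "real N * (a - 2 * \<epsilon>) \<le> x" "((a + b + 2 * \<epsilon>) * 2 + ln K) / \<delta> < x"
      by (auto simp: x\<^sub>0_def)
    define n where "n = nat \<lceil>x / (a - 2 * \<epsilon>)\<rceil>"
    have Nx: "real N \<le> x / (a - 2 * \<epsilon>)" using x \<open>a - 2 * \<epsilon> > 0\<close> by (simp add: field_simps)
    have n: "x / (a - 2 * \<epsilon>) \<le> real n" "real n \<le> x / (a - 2 * \<epsilon>) + 1"
      using Nx unfolding n_def by linarith+
    have "N \<le> n" using Nx n by linarith
    then obtain m where m: "m = n \<or> m = Suc n" "exp (- (a + \<epsilon>) * real m) \<le> \<bar>L m\<bar>"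
      using N by blast
    have "m \<ge> N" using m \<open>N \<le> n\<close> by auto
    note Nm = N[OF this]
    have m1: "x / (a - 2 * \<epsilon>) \<le> real m" "real m \<le> x / (a - 2 * \<epsilon>) + 2"
      using m n by auto
    have "exp x * \<bar>L m\<bar> \<le> exp x * exp (- (a - \<epsilon>) * real m)"
      using Nm by simp
    also have "\<dots> = exp (x - (a - \<epsilon>) * real m)" by (simp add: exp_add[symmetric] algebra_simps)
    also have "\<dots> \<le> exp (- 1)"
    proof -
      have "x \<le> (a - 2 * \<epsilon>) * real m" using m1 \<open>a - 2 * \<epsilon> > 0\<close> by (simp add: field_simps)
      moreover have "1 < \<epsilon> * real m" using Nm \<open>\<epsilon> > 0\<close> by (simp add: field_simps)
      ultimately show ?thesis by (simp add: algebra_simps)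
    qed
    also have "exp (- 1) \<le> (1 / 2 :: real)"
      using exp_ge_add_one_self[of 1] by (simp add: exp_minus field_simps)
    finally have small: "exp x * \<bar>L m\<bar> \<le> 1 / 2" .
    define E where "E = (\<Sum>i\<in>I. of_int (l i m) * (of_int (p i) - exp x * \<xi> i))"
    have "\<bar>E\<bar> \<le> (\<Sum>i\<in>I. \<bar>of_int (l i m) * (of_int (p i) - exp x * \<xi> i)\<bar>)"
      unfolding E_def by (rule sum_abs)
    also have "\<dots> \<le> (\<Sum>i\<in>I. exp ((b + \<epsilon>) * real m) * exp ((1 - \<kappa>) * x))"
    proof (intro sum_mono)
      fix i assume "i \<in> I"
      have "\<bar>of_int (p i) - exp x * \<xi> i\<bar> = exp x * \<bar>\<xi> i - of_int (p i) / of_int q\<bar>"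
      proof -
        have "of_int (p i) - exp x * \<xi> i = - (exp x * (\<xi> i - of_int (p i) / of_int q))"
          by (simp add: qx field_simps)
        then show ?thesis by (simp only: abs_minus_cancel abs_mult abs_exp_cancel)
      qed
      also have "\<dots> \<le> exp x * (1 / real_of_int q powr \<kappa>)"
        using close[OF \<open>i \<in> I\<close>] by (intro mult_left_mono) auto
      also have "\<dots> = exp ((1 - \<kappa>) * x)"
        by (simp add: qx powr_def exp_diff algebra_simps)
      finally show "\<bar>of_int (l i m) * (of_int (p i) - exp x * \<xi> i)\<bar>
          \<le> exp ((b + \<epsilon>) * real m) * exp ((1 - \<kappa>) * x)"
        unfolding abs_mult using Nm \<open>i \<in> I\<close> by (intro mult_mono) auto
    qed
    also have "\<dots> < K * (exp ((b + \<epsilon>) * real m) * exp ((1 - \<kappa>) * x))"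
      by (simp add: K_def)
    also have "\<dots> = exp (ln K + (b + \<epsilon>) * real m + (1 - \<kappa>) * x)"
      by (simp add: exp_add K_def)
    also have "\<dots> \<le> exp (x + - (a + \<epsilon>) * real m)"
    proof -
      have "(a + b + 2 * \<epsilon>) * real m \<le> (a + b + 2 * \<epsilon>) * (x / (a - 2 * \<epsilon>) + 2)"
        using m1 a_pos b_pos \<open>\<epsilon> > 0\<close> by (intro mult_left_mono) auto
      also have "\<dots> = (\<kappa> - \<delta>) * x + (a + b + 2 * \<epsilon>) * 2"
        by (simp add: \<delta>_def algebra_simps)
      finally have "(a + b + 2 * \<epsilon>) * real m \<le> (\<kappa> - \<delta>) * x + (a + b + 2 * \<epsilon>) * 2" .
      moreover have "(a + b + 2 * \<epsilon>) * 2 + ln K \<le> \<delta> * x"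
        using x(2) \<open>\<delta> > 0\<close> by (simp add: field_simps)
      ultimately show ?thesis by (simp add: algebra_simps)
    qed
    also have "\<dots> \<le> exp x * \<bar>L m\<bar>"
      unfolding exp_add using m(2) by (intro mult_left_mono) auto
    finally have E: "\<bar>E\<bar> < exp x * \<bar>L m\<bar>" .
    \<comment> \<open>Replacing each \<open>\<xi> i\<close> by \<open>p i / q\<close> in q times the
      form gives this integer, which differs from \<open>exp x * L m\<close> by \<open>E\<close>.
      Since \<open>E\<close> is strictly smaller in absolute value, z cannot vanish.\<close>
    define z where "z = q * l\<^sub>0 m + (\<Sum>i\<in>I. l i m * p i)"
    have "real_of_int z = exp x * L m + E"
      unfolding z_def E_def L_eq
      by (simp add: qx sum_subtractf sum_distrib_left algebra_simps)
    moreover have "\<bar>exp x * L m\<bar> = exp x * \<bar>L m\<bar>" by (simp add: abs_mult)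
    ultimately have "real_of_int z \<noteq> 0" "\<bar>real_of_int z\<bar> < 1"
      using E small by linarith+
    then have "z \<noteq> 0" "\<bar>z\<bar> < 1"
      by (simp_all only: of_int_abs[symmetric] of_int_less_1_iff of_int_eq_0_iff not_False_eq_True)
    then show False by linarith
  qed
qed

section \<open>Lower bound for the number of forms' variables via Dirichlet's theorem\<close>

text \<open>
  Multiplying Dirichlet's denominator by a fixed \<open>M\<close> makes it large without affecting the exponent, so
  no irrationality of the \<open>\<xi> i\<close> has to be assumed.
\<close>
lemma card_ge_exponent_ratio:
  "a / b \<le> real (card I)"
proof (rule ccontr)
  define k where "k = card I"
  assume "\<not> a / b \<le> real (card I)"
  then have kb: "real k * (b / a) < 1"
    using a_pos b_pos by (simp add: k_def field_simps)
  \<comment> \<open>Since k b / a < 1, there is room between 1 + b / a and Dirichlet's exponent 1 +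
    1 / k. The increment is small enough that multiplying it by k uses less than half of the gap 1 -
    k b / a.\<close>
  define \<kappa> where "\<kappa> = 1 + b / a + (1 - real k * (b / a)) / (2 * (real k + 1))"
  have "\<kappa> > 1 + b / a" using kb by (simp add: \<kappa>_def)
  have k\<kappa>: "real k * (\<kappa> - 1) < 1"
  proof -
    have "(1 - real k * (b / a)) * (real k / (2 * (real k + 1))) < (1 - real k * (b / a)) * 1"
      using kb by (intro mult_strict_left_mono) (auto simp: field_simps)
    then show ?thesis by (simp add: \<kappa>_def algebra_simps)
  qed
  have "\<kappa> > 1" using \<open>\<kappa> > 1 + b / a\<close> a_pos b_pos divide_pos_pos[of b a] by linarith
  obtain q\<^sub>0 :: int where q\<^sub>0: "\<And>(q::int) (p :: 'a \<Rightarrow> int). q \<ge> q\<^sub>0 \<Longrightarrow> q > 0 \<Longrightarrow>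
      \<exists>i\<in>I. \<bar>\<xi> i - real_of_int (p i) / real_of_int q\<bar> \<ge> 1 / real_of_int q powr \<kappa>"
    using simultaneous_approximation_exponent[OF \<open>\<kappa> > 1 + b / a\<close>] by blast
  define M where "M = max 1 q\<^sub>0"
  have M: "M \<ge> 1" "M \<ge> q\<^sub>0" by (auto simp: M_def)
  \<comment> \<open>The exponent is positive, so N can be chosen to absorb the cost
    \<open>M powr \<kappa>\<close> of the scaling. With q \<le> N^k this yields Q^\<kappa> \<le> N
    q, hence Dirichlet's error 1 / (N q) is at most 1 / Q^\<kappa>.\<close>
  have "filterlim (\<lambda>N. real N powr (1 - real k * (\<kappa> - 1))) at_top sequentially"
    using k\<kappa> by real_asymp
  then have "\<forall>\<^sub>F N in sequentially. real_of_int M powr \<kappa> \<le> real N powr (1 - real k * (\<kappa> - 1))"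
    by (simp add: filterlim_at_top)
  then have "\<forall>\<^sub>F N in sequentially. real_of_int M powr \<kappa> \<le> real N powr (1 - real k * (\<kappa> - 1)) \<and> N > 0"
    using eventually_gt_at_top[of 0] by eventually_elim simp
  then obtain N where N: "real_of_int M powr \<kappa> \<le> real N powr (1 - real k * (\<kappa> - 1))" "N > 0"
    unfolding eventually_sequentially by blast
  obtain g where g: "bij_betw g I {..<k}"
    unfolding k_def lessThan_atLeast0 using ex_bij_betw_finite_nat[OF finite_I] by blast
  obtain q p where q: "0 < q" "q \<le> int (N ^ k)"
    and p: "\<And>j. j < k \<Longrightarrow> \<bar>of_int q * \<xi> (inv_into I g j) - of_int (p j)\<bar> < 1 / real N"
    using Dirichlet_approx_simult[OF \<open>N > 0\<close>, of k "\<lambda>j. \<xi> (inv_into I g j)"] by blast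
  define Q where "Q = M * q"
  have "Q > 0" using M q by (simp add: Q_def)
  moreover have "Q \<ge> q\<^sub>0"
  proof -
    have "M * 1 \<le> M * q" using M q by (intro mult_left_mono) auto
    then have "M \<le> Q" by (simp only: Q_def mult_1_right)
    with M show ?thesis by linarith
  qed
  ultimately obtain i where i: "i \<in> I"
    "\<bar>\<xi> i - real_of_int (M * p (g i)) / real_of_int Q\<bar> \<ge> 1 / real_of_int Q powr \<kappa>"
    using q\<^sub>0[of Q "\<lambda>i. M * p (g i)"] by blast
  have gi: "g i < k" "inv_into I g (g i) = i"
    using g i by (auto simp: bij_betw_def)
  have MN: "real_of_int M powr \<kappa> * real N powr (real k * (\<kappa> - 1)) \<le> real N"
  proof -
    have "real_of_int M powr \<kappa> * real N powr (real k * (\<kappa> - 1))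
        \<le> real N powr (1 - real k * (\<kappa> - 1)) * real N powr (real k * (\<kappa> - 1))"
      using N by (intro mult_right_mono) auto
    also have "\<dots> = real N" using N by (simp add: powr_add[symmetric])
    finally show ?thesis .
  qed
  have "real_of_int q \<le> real_of_int (int (N ^ k))"
    using q(2) by (simp only: of_int_le_iff)
  then have "real_of_int q \<le> real N powr real k" using N by (simp add: powr_realpow)
  then have "real_of_int q powr (\<kappa> - 1) \<le> (real N powr real k) powr (\<kappa> - 1)"
    using \<open>\<kappa> > 1\<close> q by (intro powr_mono2) auto
  then have "real_of_int M powr \<kappa> * real_of_int q powr (\<kappa> - 1) \<le>
      real_of_int M powr \<kappa> * real N powr (real k * (\<kappa> - 1))"
    by (intro mult_left_mono) (auto simp: powr_powr)
  with MN have "real_of_int M powr \<kappa> * real_of_int q powr (\<kappa> - 1) \<le> real N" by linarith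
  moreover have "real_of_int Q powr \<kappa> = real_of_int M powr \<kappa> * real_of_int q powr (\<kappa> - 1) * real_of_int q"
    using M q powr_add[of "real_of_int q" "\<kappa> - 1" 1] by (simp add: Q_def powr_mult)
  ultimately have "real_of_int Q powr \<kappa> \<le> real N * real_of_int q"
    using q by (simp add: mult_right_mono)
  moreover have "real_of_int Q powr \<kappa> > 0" using \<open>Q > 0\<close> by simp
  ultimately have "1 / (real N * real_of_int q) \<le> 1 / real_of_int Q powr \<kappa>"
    by (intro divide_left_mono mult_pos_pos) (use N q in auto)
  moreover have "\<bar>\<xi> i - real_of_int (M * p (g i)) / real_of_int Q\<bar> < 1 / (real N * real_of_int q)"
  proof -
    \<comment> \<open>The factor \<open>M\<close> cancels: scaling changes the denominator but not
      the fractions.\<close>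
    have "\<xi> i - real_of_int (M * p (g i)) / real_of_int Q
        = (of_int q * \<xi> i - of_int (p (g i))) / real_of_int q"
      using M q by (simp add: Q_def field_simps)
    then have "\<bar>\<xi> i - real_of_int (M * p (g i)) / real_of_int Q\<bar>
        = \<bar>of_int q * \<xi> i - of_int (p (g i))\<bar> / real_of_int q"
      using q by (simp add: abs_divide)
    also have "\<dots> < 1 / real N / real_of_int q"
      using p[OF gi(1)] q gi(2) by (intro divide_strict_right_mono) auto
    finally show ?thesis by simp
  qed
  ultimately show False using i by linarith
qed

end

section \<open>Integer coordinates in a rational basis\<close>

lemma ex_common_denominator:
  assumes "finite (A :: rat set)"
  shows "\<exists>D::int. D > 0 \<and> (\<forall>c\<in>A. of_int D * c \<in> \<int>)"
  using assms
proof induction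
  case empty
  show ?case by (rule exI[of _ 1]) simp
next
  case (insert c A)
  then obtain D :: int where D: "D > 0" "\<forall>c\<in>A. of_int D * c \<in> \<int>" by blast
  obtain s t where st: "quotient_of c = (s, t)" by fastforce
  have t: "t > 0" "c = of_int s / of_int t"
    using quotient_of_denom_pos[OF st] quotient_of_div[OF st] by auto
  have "of_int (D * t) * c = of_int (D * s)" using t by simp
  moreover have "of_int (D * t) * c' = of_int t * (of_int D * c')" for c' :: rat by simp
  ultimately show ?case using D t
    by (intro exI[of _ "D * t"]) (metis Ints_mult Ints_of_int insert_iff zero_less_mult_iff)
qed

text \<open>Extend {1} to a maximal rationally independent subset of \<open>X\<close> and clear the
  finitely many denominators of all coordinates at once. Keeping 1 in the basis lets its coefficient
  act as the constant term of a form, which leaves one number fewer than the dimension.\<close>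

lemma integer_coordinates:
  assumes "finite X" "1 \<in> X"
  obtains B D k where "B \<subseteq> X" "1 \<in> B" "card B = rat_vs.dim X" "D > (0::int)"
    "\<And>x. x \<in> X \<Longrightarrow> of_int D * x = (\<Sum>b\<in>B. of_int (k x b :: int) * b)"
proof -
  have "rat_vs.independent {1::real}" by simp
  then obtain B where B: "{1} \<subseteq> B" "B \<subseteq> X" "rat_vs.independent B" "X \<subseteq> rat_vs.span B"
    using rat_vs.maximal_independent_subset_extend[of "{1}" X] assms by auto
  have "finite B" using B assms finite_subset by blast
  have "\<exists>c. x = (\<Sum>b\<in>B. of_rat (c b) * b)" if "x \<in> X" for x
    using that B(4) unfolding rat_vs.span_finite[OF \<open>finite B\<close>] by auto
  then obtain c where c: "\<And>x. x \<in> X \<Longrightarrow> x = (\<Sum>b\<in>B. of_rat (c x b) * b)" by metis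
  obtain D :: int where D: "D > 0" "\<forall>z\<in>(\<lambda>(x, b). c x b) ` (X \<times> B). of_int D * z \<in> \<int>"
    using ex_common_denominator[of "(\<lambda>(x, b). c x b) ` (X \<times> B)"] \<open>finite B\<close> assms by auto
  have "\<exists>j::int. of_int D * c x b = of_int j" if "x \<in> X" "b \<in> B" for x b
    using D(2) that by (fastforce elim: Ints_cases)
  then obtain k :: "real \<Rightarrow> real \<Rightarrow> int"
    where k: "\<And>x b. x \<in> X \<Longrightarrow> b \<in> B \<Longrightarrow> of_int D * c x b = of_int (k x b)" by metis
  have "of_int D * x = (\<Sum>b\<in>B. of_int (k x b) * b)" if "x \<in> X" for x
  proof -
    have "of_int D * x = (\<Sum>b\<in>B. of_int D * (of_rat (c x b) * b))"
      by (subst c[OF that]) (simp add: sum_distrib_left)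
    also have "\<dots> = (\<Sum>b\<in>B. of_rat (of_int D * c x b) * b)"
      by (simp add: of_rat_mult mult.assoc)
    also have "\<dots> = (\<Sum>b\<in>B. of_int (k x b) * b)"
      using k[OF that] by (intro sum.cong) auto
    finally show ?thesis .
  qed
  with B D show thesis by (intro that[of B D k]) (auto simp: rat_vs.basis_card_eq_dim)
qed

section \<open>Exponential estimates for the given forms, and the two conclusions\<close>

theorem theorem1:
  fixes r :: nat
    and \<xi> :: "nat \<Rightarrow> real"
    and \<alpha> \<beta> \<omega> \<phi> :: real
    and l :: "nat \<Rightarrow> nat \<Rightarrow> int"
  assumes "r \<ge> 1"
    and "0 < \<alpha>" and "\<alpha> < 1" and "\<beta> > 1"
    and "\<not> (\<exists>k::int. \<omega> - 0 = of_int k * pi) \<or> \<not> (\<exists>k::int. \<phi> - pi / 2 = of_int k * pi)"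
    and "\<exists>u :: nat \<Rightarrow> real.
           (\<lambda>n. u n / real n) \<longlonglongrightarrow> 0 \<and>
           (\<forall>n\<ge>1. (MAX i\<in>{0..r}. real_of_int \<bar>l i n\<bar>) \<le> \<beta> powr (real n + u n))"
    and "\<exists>(v :: nat \<Rightarrow> real) (w :: nat \<Rightarrow> real).
           (\<lambda>n. v n / real n) \<longlonglongrightarrow> 0 \<and> w \<longlonglongrightarrow> 0 \<and>
           (\<forall>n\<ge>1. \<bar>real_of_int (l 0 n) + (\<Sum>i=1..r. real_of_int (l i n) * \<xi> i)\<bar>
                    = \<alpha> powr (real n + v n) * (\<bar>cos (real n * \<omega> + \<phi>)\<bar> + w n))"
  shows "real (rat_vs.dim (rat_vs.span (insert 1 (\<xi> ` {1..r})))) \<ge> 1 - ln \<alpha> / ln \<beta>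
    \<and> (\<forall>\<kappa>::real. \<kappa> > 1 - ln \<beta> / ln \<alpha> \<longrightarrow>
         (\<exists>q\<^sub>0::int. \<forall>(q::int) (p :: nat \<Rightarrow> int). q \<ge> q\<^sub>0 \<and> q > 0 \<longrightarrow>
            (MAX i\<in>{1..r}. \<bar>\<xi> i - real_of_int (p i) / real_of_int q\<bar>)
              \<ge> 1 / real_of_int q powr \<kappa>))"
proof -
  obtain u :: "nat \<Rightarrow> real" where u: "(\<lambda>n. u n / real n) \<longlonglongrightarrow> 0"
    and l_le: "\<And>n. n \<ge> 1 \<Longrightarrow> (MAX i\<in>{0..r}. real_of_int \<bar>l i n\<bar>) \<le> \<beta> powr (real n + u n)"
    using assms(6) by blast
  define L where "L n = real_of_int (l 0 n) + (\<Sum>i=1..r. real_of_int (l i n) * \<xi> i)" for n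
  obtain v w :: "nat \<Rightarrow> real" where v: "(\<lambda>n. v n / real n) \<longlonglongrightarrow> 0" and w: "w \<longlonglongrightarrow> 0"
    and L: "\<And>n. n \<ge> 1 \<Longrightarrow> \<bar>L n\<bar> = \<alpha> powr (real n + v n) * (\<bar>cos (real n * \<omega> + \<phi>)\<bar> + w n)"
    using assms(7) unfolding L_def by blast
  obtain c where c: "c > 0" "\<And>n. \<exists>m\<in>{n, Suc n}. c \<le> \<bar>cos (real m * \<omega> + \<phi>)\<bar>"
    using cos_oscillation_lower_bound[OF assms(5)] by blast
  \<comment> \<open>The factor \<open>C\<close> prepares for integer combinations of the
    coefficients in (i); for (ii) it is 1. Likewise the factor \<open>D\<close> in the next two
    estimates is a common denominator in (i) and 1 in (ii).\<close>
  have coeff: "\<forall>\<^sub>F n in sequentially. \<forall>i\<in>{0..r}. C * \<bar>of_int (l i n)\<bar> \<le> exp ((ln \<beta> + \<epsilon>) * real n)"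
    if "C > 0" "\<epsilon> > 0" for C \<epsilon> :: real
    using eventually_mult_powr_le_exp[OF u _ that, of \<beta>, OF order.strict_trans[OF zero_less_one \<open>\<beta> > 1\<close>]]
      eventually_ge_at_top[of 1]
  proof eventually_elim
    case (elim n)
    have "real_of_int \<bar>l i n\<bar> \<le> \<beta> powr (real n + u n)" if "i \<in> {0..r}" for i
      using l_le[OF elim(2)] that by (subst (asm) Max_le_iff) auto
    then have "C * real_of_int \<bar>l i n\<bar> \<le> C * \<beta> powr (real n + u n)" if "i \<in> {0..r}" for i
      using that \<open>C > 0\<close> by (intro mult_left_mono) auto
    with elim(1) show ?case by fastforce
  qed
  have upper: "\<forall>\<^sub>F n in sequentially. \<bar>D * L n\<bar> \<le> exp (- (- ln \<alpha> - \<epsilon>) * real n)"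
    if "D > 0" "\<epsilon> > 0" for D \<epsilon> :: real
  proof -
    have "\<forall>\<^sub>F n in sequentially. w n < 1" using w by (rule order_tendstoD) simp
    moreover have "\<forall>\<^sub>F n in sequentially. 2 * D * \<alpha> powr (real n + v n) \<le> exp ((ln \<alpha> + \<epsilon>) * real n)"
      using v \<open>0 < \<alpha>\<close> that by (intro eventually_mult_powr_le_exp) auto
    ultimately show ?thesis using eventually_ge_at_top[of 1]
    proof eventually_elim
      case (elim n)
      have "\<bar>D * L n\<bar> = D * \<alpha> powr (real n + v n) * (\<bar>cos (real n * \<omega> + \<phi>)\<bar> + w n)"
        using L[OF elim(3)] \<open>D > 0\<close> by (simp add: abs_mult)
      also have "\<dots> \<le> D * \<alpha> powr (real n + v n) * 2"
      proof (rule mult_left_mono)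
        show "\<bar>cos (real n * \<omega> + \<phi>)\<bar> + w n \<le> 2"
          using elim(1) abs_cos_le_one[of "real n * \<omega> + \<phi>"] by linarith
      qed (use \<open>D > 0\<close> in auto)
      also have "\<dots> \<le> exp ((ln \<alpha> + \<epsilon>) * real n)" using elim(2) by (simp add: mult_ac)
      finally show ?case by (simp add: algebra_simps)
    qed
  qed
  have lower: "\<forall>\<^sub>F n in sequentially. \<exists>m\<in>{n, Suc n}. exp (- (- ln \<alpha> + \<epsilon>) * real m) \<le> \<bar>D * L m\<bar>"
    if "D > 0" "\<epsilon> > 0" for D \<epsilon> :: real
  proof -
    \<comment> \<open>Where the cosine is at least \<open>c\<close> in absolute value, its sum with
      \<open>w n\<close> stays above \<open>c / 2\<close>.\<close>
    have "\<forall>\<^sub>F n in sequentially. - (c / 2) < w n" using w by (rule order_tendstoD) (use c in simp)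
    moreover have "\<forall>\<^sub>F n in sequentially.
        exp ((ln \<alpha> - \<epsilon>) * real n) \<le> c / 2 * D * \<alpha> powr (real n + v n)"
      using v \<open>0 < \<alpha>\<close> that c by (intro eventually_exp_le_mult_powr) auto
    ultimately have "\<forall>\<^sub>F n in sequentially. c \<le> \<bar>cos (real n * \<omega> + \<phi>)\<bar> \<longrightarrow>
        exp (- (- ln \<alpha> + \<epsilon>) * real n) \<le> \<bar>D * L n\<bar>"
      using eventually_ge_at_top[of 1]
    proof eventually_elim
      case (elim n)
      show ?case
      proof
        assume cos: "c \<le> \<bar>cos (real n * \<omega> + \<phi>)\<bar>"
        have "exp (- (- ln \<alpha> + \<epsilon>) * real n) \<le> D * \<alpha> powr (real n + v n) * (c / 2)"
          using elim(2) by (simp add: algebra_simps)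
        also have "\<dots> \<le> D * \<alpha> powr (real n + v n) * (\<bar>cos (real n * \<omega> + \<phi>)\<bar> + w n)"
          using elim(1) cos \<open>D > 0\<close> by (intro mult_left_mono) auto
        also have "\<dots> = \<bar>D * L n\<bar>"
          using L[OF elim(3)] \<open>D > 0\<close> by (simp add: abs_mult)
        finally show "exp (- (- ln \<alpha> + \<epsilon>) * real n) \<le> \<bar>D * L n\<bar>" .
      qed
    qed
    \<comment> \<open>An explicit threshold is needed because the good index may be \<open>n\<close>
      or \<open>Suc n\<close>; both lie beyond \<open>N\<close>.\<close>
    then obtain N where "\<And>n. n \<ge> N \<Longrightarrow> c \<le> \<bar>cos (real n * \<omega> + \<phi>)\<bar> \<Longrightarrow>
        exp (- (- ln \<alpha> + \<epsilon>) * real n) \<le> \<bar>D * L n\<bar>"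
      unfolding eventually_sequentially by blast
    moreover have "m \<ge> N" if "n \<ge> N" "m \<in> {n, Suc n}" for n m using that by auto
    ultimately show ?thesis
      using c(2) unfolding eventually_sequentially by meson
  qed
  have ln_pos: "- ln \<alpha> > 0" "ln \<beta> > 0" using assms by auto

  \<comment> \<open>Conclusion (i): the dimension\<close>
  have "1 - ln \<alpha> / ln \<beta> \<le> real (rat_vs.dim (rat_vs.span (insert 1 (\<xi> ` {1..r}))))"
  proof -
    define X where "X = insert 1 (\<xi> ` {1..r})"
    obtain B D k where B: "B \<subseteq> X" "1 \<in> B" "card B = rat_vs.dim X" "D > (0::int)"
      and k: "\<And>x. x \<in> X \<Longrightarrow> of_int D * x = (\<Sum>b\<in>B. of_int (k x b :: int) * b)"
      by (rule integer_coordinates[of X]) (auto simp: X_def)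
    have "finite B" using B by (auto simp: X_def intro: finite_subset)
    define x where "x i = (if i = 0 then 1 else \<xi> i)" for i
    have x: "x i \<in> X" if "i \<in> {0..r}" for i using that by (auto simp: x_def X_def)
    \<comment> \<open>The coefficient of the basis element \<open>b\<close> in
      \<open>D * L n\<close>; with \<open>x 0 = 1\<close> the constant term needs no separate
      treatment.\<close>
    define m where "m b n = (\<Sum>i=0..r. k (x i) b * l i n)" for b n
    \<comment> \<open>A bound, uniform in \<open>b\<close>, for the sum of the absolute values of
      the coordinates that enter \<open>m b n\<close>. It does not depend on n, so the growth rate
      \<open>ln \<beta>\<close> is preserved.\<close>
    define C where "C = 1 + (\<Sum>b\<in>B. \<Sum>i=0..r. \<bar>real_of_int (k (x i) b)\<bar>)"
    have "C > 0" unfolding C_def by (intro add_pos_nonneg sum_nonneg) auto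
    have k_le: "(\<Sum>i=0..r. \<bar>real_of_int (k (x i) b)\<bar>) \<le> C" if "b \<in> B" for b
      using member_le_sum[OF that, of "\<lambda>b. \<Sum>i=0..r. \<bar>real_of_int (k (x i) b)\<bar>"] \<open>finite B\<close>
      by (simp add: C_def sum_nonneg)
    have L_x: "L n = (\<Sum>i=0..r. of_int (l i n) * x i)" for n
      unfolding L_def by (subst sum.atLeast_Suc_atMost) (auto simp: x_def intro!: sum.cong)
    have DL: "of_int D * L n = (\<Sum>b\<in>B. of_int (m b n) * b)" for n
    proof -
      have "of_int D * L n = (\<Sum>i=0..r. of_int (l i n) * (of_int D * x i))"
        by (simp add: L_x sum_distrib_left mult_ac)
      also have "\<dots> = (\<Sum>i=0..r. \<Sum>b\<in>B. of_int (l i n) * (of_int (k (x i) b) * b))"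
        using k[OF x] by (intro sum.cong) (auto simp: sum_distrib_left)
      also have "\<dots> = (\<Sum>b\<in>B. of_int (m b n) * b)"
        by (subst sum.swap) (simp add: m_def sum_distrib_left sum_distrib_right mult_ac)
      finally show ?thesis .
    qed
    interpret small_linear_forms "B - {1}" "\<lambda>b. b" "m 1" m "\<lambda>n. of_int D * L n" "- ln \<alpha>" "ln \<beta>"
    proof
      show "of_int D * L n = of_int (m 1 n) + (\<Sum>b\<in>B - {1}. of_int (m b n) * b)" for n
        unfolding DL by (subst sum.remove[of _ 1]) (use \<open>finite B\<close> B in auto)
      show "\<forall>\<^sub>F n in sequentially. \<forall>b\<in>B - {1}. \<bar>of_int (m b n)\<bar> \<le> exp ((ln \<beta> + \<epsilon>) * real n)"
        if "\<epsilon> > 0" for \<epsilon>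
        using coeff[OF \<open>C > 0\<close> that]
      proof eventually_elim
        case (elim n)
        define E where "E = exp ((ln \<beta> + \<epsilon>) * real n)"
        show ?case
        proof
          fix b assume "b \<in> B - {1}"
          have "\<bar>real_of_int (m b n)\<bar> \<le> (\<Sum>i=0..r. \<bar>real_of_int (k (x i) b)\<bar> * \<bar>real_of_int (l i n)\<bar>)"
            unfolding m_def of_int_sum of_int_mult abs_mult[symmetric] by (rule sum_abs)
          also have "\<dots> \<le> (\<Sum>i=0..r. \<bar>real_of_int (k (x i) b)\<bar> * (E / C))"
            using elim \<open>C > 0\<close> by (intro sum_mono mult_left_mono) (auto simp: E_def field_simps)
          also have "\<dots> = (\<Sum>i=0..r. \<bar>real_of_int (k (x i) b)\<bar>) * (E / C)"
            by (rule sum_distrib_right[symmetric])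
          also have "\<dots> \<le> C * (E / C)"
            using k_le \<open>b \<in> B - {1}\<close> \<open>C > 0\<close> by (intro mult_right_mono) (auto simp: E_def)
          finally show "\<bar>real_of_int (m b n)\<bar> \<le> exp ((ln \<beta> + \<epsilon>) * real n)"
            using \<open>C > 0\<close> by (simp add: E_def)
        qed
      qed
      show "\<forall>\<^sub>F n in sequentially. \<bar>of_int D * L n\<bar> \<le> exp (- (- ln \<alpha> - \<epsilon>) * real n)"
        if "\<epsilon> > 0" for \<epsilon>
        by (rule upper) (use B that in auto)
      show "\<forall>\<^sub>F n in sequentially. \<exists>m\<in>{n, Suc n}.
          exp (- (- ln \<alpha> + \<epsilon>) * real m) \<le> \<bar>of_int D * L m\<bar>"
        if "\<epsilon> > 0" for \<epsilon>
        by (rule lower) (use B that in auto)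
    qed (use \<open>finite B\<close> ln_pos in auto)
    \<comment> \<open>The removed element 1 accounts for the summand 1 in the dimension bound; the
      other basis elements number at least \<open>- ln \<alpha> / ln \<beta>\<close>.\<close>
    have "card B = Suc (card (B - {1}))"
      using B \<open>finite B\<close> by (simp only: card_Suc_Diff1)
    then show ?thesis using card_ge_exponent_ratio B(3) by (simp add: X_def)
  qed

  \<comment> \<open>Conclusion (ii): simultaneous approximation\<close>
  moreover have "\<forall>\<kappa>::real. \<kappa> > 1 - ln \<beta> / ln \<alpha> \<longrightarrow>
         (\<exists>q\<^sub>0::int. \<forall>(q::int) (p :: nat \<Rightarrow> int). q \<ge> q\<^sub>0 \<and> q > 0 \<longrightarrow>
            (MAX i\<in>{1..r}. \<bar>\<xi> i - real_of_int (p i) / real_of_int q\<bar>)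
              \<ge> 1 / real_of_int q powr \<kappa>)"
  proof (intro allI impI)
    fix \<kappa> :: real assume "\<kappa> > 1 - ln \<beta> / ln \<alpha>"
    interpret small_linear_forms "{1..r}" \<xi> "l 0" l L "- ln \<alpha>" "ln \<beta>"
    proof
      show "\<forall>\<^sub>F n in sequentially. \<forall>i\<in>{1..r}. \<bar>of_int (l i n)\<bar> \<le> exp ((ln \<beta> + \<epsilon>) * real n)"
        if "\<epsilon> > 0" for \<epsilon>
        using coeff[OF zero_less_one that] by eventually_elim auto
      show "\<forall>\<^sub>F n in sequentially. \<bar>L n\<bar> \<le> exp (- (- ln \<alpha> - \<epsilon>) * real n)"
        if "\<epsilon> > 0" for \<epsilon>
        using upper[OF zero_less_one that] by (simp only: mult_1_left)
      show "\<forall>\<^sub>F n in sequentially. \<exists>m\<in>{n, Suc n}.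
          exp (- (- ln \<alpha> + \<epsilon>) * real m) \<le> \<bar>L m\<bar>"
        if "\<epsilon> > 0" for \<epsilon>
        using lower[OF zero_less_one that] by (simp only: mult_1_left)
    qed (use ln_pos in \<open>auto simp: L_def\<close>)
    obtain q\<^sub>0 :: int where q\<^sub>0: "\<And>(q::int) (p :: nat \<Rightarrow> int). q \<ge> q\<^sub>0 \<Longrightarrow> q > 0 \<Longrightarrow>
        \<exists>i\<in>{1..r}. \<bar>\<xi> i - real_of_int (p i) / real_of_int q\<bar> \<ge> 1 / real_of_int q powr \<kappa>"
      using simultaneous_approximation_exponent[of \<kappa>] \<open>\<kappa> > _\<close> by auto
    show "\<exists>q\<^sub>0::int. \<forall>(q::int) (p :: nat \<Rightarrow> int). q \<ge> q\<^sub>0 \<and> q > 0 \<longrightarrow>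
            (MAX i\<in>{1..r}. \<bar>\<xi> i - real_of_int (p i) / real_of_int q\<bar>)
              \<ge> 1 / real_of_int q powr \<kappa>"
    proof (intro exI[of _ q\<^sub>0] allI impI)
      fix q :: int and p :: "nat \<Rightarrow> int"
      assume "q \<ge> q\<^sub>0 \<and> q > 0"
      then show "(MAX i\<in>{1..r}. \<bar>\<xi> i - real_of_int (p i) / real_of_int q\<bar>)
          \<ge> 1 / real_of_int q powr \<kappa>"
        \<comment> \<open>Here r \<ge> 1 ensures that the maximum is over a nonempty set.\<close>
        using q\<^sub>0[of q p] \<open>r \<ge> 1\<close> by (subst Max_ge_iff) auto
    qed
  qed
  ultimately show ?thesis by blast
qed

end
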